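(* Let $\mathcal{G}$ be a complex Hilbert space, let $\mathcal{H}$ and $\mathcal{H}_k$, $k\in\mathbb{N}$, be closed subspaces of $\mathcal{G}$, and let $T$ and $T_k$, $k\in\mathbb{N}$, be closed, densely defined operators acting in the Hilbert spaces $\mathcal{H}$ and $\mathcal{H}_k$, respectively, such that $\bigcap_{k\in\mathbb{N}}\rho(T_k)\cap\rho(T)\neq\emptyset$. Let $K\subset\mathbb{C}$ be compact and $\varepsilon>0$. Suppose that i) $\overline{\sigma_{\varepsilon}(T)}\cap K=\overline{\sigma_{\varepsilon}(T)\cap K}\neq\emptyset$; ii) the function $\lambda\mapsto\|(T-\lambda)^{-1}\|$ is non-constant on every non-empty open subset of $\rho(T)$; iii) $T_k$ converges to $T$ in the generalised norm resolvent sense. Then $$d_{\rm H}\left(\overline{\sigma_{\varepsilon}(T_k)}\cap K,\ \overline{\sigma_{\varepsilon}(T)}\cap K\right)\longrightarrow 0,\qquad k\to\infty.$$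
   Context: For a closed operator $T$ and $\varepsilon>0$, the $\varepsilon$-pseudospectrum is $\sigma_\varepsilon(T):=\{z\in\mathbb{C}: \|(T-z)^{-1}\|>1/\varepsilon\}$, with the convention $\|(T-z)^{-1}\|=\infty$ for $z\in\sigma(T)$; $\rho(T)$ is the resolvent set and $\sigma(T)$ the spectrum. Let $P$ and $P_k$ denote the orthogonal projections of $\mathcal{G}$ onto $\mathcal{H}$ and $\mathcal{H}_k$, respectively. $T_k$ converges to $T$ in the generalised norm resolvent sense if there exists $\lambda_0\in\bigcap_{k\in\mathbb{N}}\rho(T_k)\cap\rho(T)$ such that $\|(T_k-\lambda_0)^{-1}P_k-(T-\lambda_0)^{-1}P\|\to0$ as $k\to\infty$ (operator norm of bounded operators on $\mathcal{G}$). For non-empty compact sets $K_1,K_2\subset\mathbb{C}$ the Hausdorff distance is $d_{\rm H}(K_1,K_2):=\max\{\sup_{z\in K_1}\mathrm{dist}(z,K_2),\ \sup_{z\in K_2}\mathrm{dist}(z,K_1)\}$, where $\mathrm{dist}(z,K_j):=\inf_{w\in K_j}|z-w|$. The convergence of the Hausdorff distances includes the assertion that the sets $\overline{\sigma_\varepsilon(T_k)}\cap K$ are non-empty for all sufficiently large $k$. *)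

theory Defs
  imports "HOL-Analysis.Analysis"
begin

section \<open>Complex Hilbert spaces\<close>

text \<open>
  The real inner product of the parent class is the real part of the complex one, so that norm,
  metric and topology are those induced by \<open>cinner\<close>.  The latter is linear in its second argument.
\<close>

class chilbert_space = real_inner + banach +
  fixes scaleC :: "complex \<Rightarrow> 'a \<Rightarrow> 'a" (infixr \<open>*\<^sub>C\<close> 75)
    and cinner :: "'a \<Rightarrow> 'a \<Rightarrow> complex"
  assumes scaleC_of_real: "of_real r *\<^sub>C x = r *\<^sub>R x"
    and scaleC_add_right: "a *\<^sub>C (x + y) = a *\<^sub>C x + a *\<^sub>C y"
    and scaleC_add_left: "(a + b) *\<^sub>C x = a *\<^sub>C x + b *\<^sub>C x"
    and scaleC_scaleC: "a *\<^sub>C b *\<^sub>C x = (a * b) *\<^sub>C x"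
    and cinner_commute: "cinner x y = cnj (cinner y x)"
    and cinner_add_right: "cinner x (y + z) = cinner x y + cinner x z"
    and cinner_scaleC_right: "cinner x (a *\<^sub>C y) = a * cinner x y"
    and Re_cinner: "Re (cinner x y) = inner x y"

instantiation complex :: chilbert_space
begin

definition "scaleC_complex (a::complex) (x::complex) = a * x"
definition "cinner_complex (x::complex) (y::complex) = cnj x * y"

instance
  by standard
    (auto simp: scaleC_complex_def cinner_complex_def inner_complex_def scaleR_conv_of_real
      algebra_simps)

end

definition closed_csubspace :: "'a::chilbert_space set \<Rightarrow> bool" where
  "closed_csubspace S \<longleftrightarrow>
     closed S \<and> 0 \<in> S \<and> (\<forall>x\<in>S. \<forall>y\<in>S. x + y \<in> S) \<and> (\<forall>a. \<forall>x\<in>S. a *\<^sub>C x \<in> S)"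

definition orth_proj :: "'a::chilbert_space set \<Rightarrow> 'a \<Rightarrow> 'a" where
  "orth_proj S x = (THE y. y \<in> S \<and> (\<forall>h\<in>S. cinner h (x - y) = 0))"

text \<open>
  Operator norm of a bounded operator defined on a subspace \<open>S\<close>; it equals \<open>0\<close> for \<open>S = {0}\<close>,
  and \<open>onorm\<close> is the case \<open>S = UNIV\<close>.
\<close>

definition onorm_on :: "'a::real_normed_vector set \<Rightarrow> ('a \<Rightarrow> 'b::real_normed_vector) \<Rightarrow> real" where
  "onorm_on S f = (SUP x\<in>S. norm (f x) / norm x)"

section \<open>Unbounded operators\<close>

text \<open>
  An operator is given by its domain together with a total function whose values outside the
  domain are irrelevant.  The Hilbert space \<open>H\<close> in which it acts, a closed subspace of the ambient
  type, is passed as an explicit argument below.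
\<close>

record 'a operator =
  op_dom :: "'a set"
  op_fun :: "'a \<Rightarrow> 'a"

definition linear_operator_in :: "'a::chilbert_space set \<Rightarrow> 'a operator \<Rightarrow> bool" where
  "linear_operator_in H T \<longleftrightarrow>
     op_dom T \<subseteq> H \<and> op_fun T ` op_dom T \<subseteq> H \<and> 0 \<in> op_dom T \<and>
     (\<forall>x\<in>op_dom T. \<forall>y\<in>op_dom T.
        x + y \<in> op_dom T \<and> op_fun T (x + y) = op_fun T x + op_fun T y) \<and>
     (\<forall>a. \<forall>x\<in>op_dom T. a *\<^sub>C x \<in> op_dom T \<and> op_fun T (a *\<^sub>C x) = a *\<^sub>C op_fun T x)"

definition closed_operator :: "'a::chilbert_space operator \<Rightarrow> bool" where
  "closed_operator T \<longleftrightarrow> closed {(x, op_fun T x) | x. x \<in> op_dom T}"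

definition densely_defined_in :: "'a::chilbert_space set \<Rightarrow> 'a operator \<Rightarrow> bool" where
  "densely_defined_in H T \<longleftrightarrow> H \<subseteq> closure (op_dom T)"

definition op_shift :: "'a::chilbert_space operator \<Rightarrow> complex \<Rightarrow> 'a \<Rightarrow> 'a" where
  "op_shift T z x = op_fun T x - z *\<^sub>C x"

text \<open>The resolvent \<open>(T - z)\<^sup>-\<^sup>1\<close>; it is meaningful only on \<open>H\<close> and for \<open>z\<close> in the resolvent set.\<close>

definition resolvent :: "'a::chilbert_space operator \<Rightarrow> complex \<Rightarrow> 'a \<Rightarrow> 'a" where
  "resolvent T z = inv_into (op_dom T) (op_shift T z)"

definition resolvent_set :: "'a::chilbert_space set \<Rightarrow> 'a operator \<Rightarrow> complex set" where
  "resolvent_set H T =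
     {z. bij_betw (op_shift T z) (op_dom T) H \<and>
         (\<exists>C. \<forall>y\<in>H. norm (resolvent T z y) \<le> C * norm y)}"

definition spectrum :: "'a::chilbert_space set \<Rightarrow> 'a operator \<Rightarrow> complex set" where
  "spectrum H T = - resolvent_set H T"

definition resolvent_norm :: "'a::chilbert_space set \<Rightarrow> 'a operator \<Rightarrow> complex \<Rightarrow> ereal" where
  "resolvent_norm H T z =
     (if z \<in> spectrum H T then \<infinity> else ereal (onorm_on H (resolvent T z)))"

definition pseudospectrum ::
    "'a::chilbert_space set \<Rightarrow> 'a operator \<Rightarrow> real \<Rightarrow> complex set" where
  "pseudospectrum H T \<epsilon> = {z. resolvent_norm H T z > ereal (1 / \<epsilon>)}"

definition gen_norm_resolvent_convergence ::
    "(nat \<Rightarrow> 'a::chilbert_space set) \<Rightarrow> (nat \<Rightarrow> 'a operator) \<Rightarrow>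
     'a set \<Rightarrow> 'a operator \<Rightarrow> bool" where
  "gen_norm_resolvent_convergence Hk Tk H T \<longleftrightarrow>
     (\<exists>z \<in> (\<Inter>k. resolvent_set (Hk k) (Tk k)) \<inter> resolvent_set H T.
        (\<lambda>k. onorm (\<lambda>x. resolvent (Tk k) z (orth_proj (Hk k) x) - resolvent T z (orth_proj H x)))
          \<longlonglongrightarrow> 0)"

section \<open>Hausdorff distance\<close>

text \<open>Only meaningful for non-empty compact sets.\<close>

definition hausdorff_dist :: "complex set \<Rightarrow> complex set \<Rightarrow> real" where
  "hausdorff_dist A B = max (SUP z\<in>A. infdist z B) (SUP z\<in>B. infdist z A)"

end

theory Submission
  imports Defs "HOL-Complex_Analysis.Cauchy_Integral_Formula"
begin

text \<open>
  Extend the resolvents by \<open>0\<close> to bounded operators \<open>R(z)\<close>, \<open>R\<^sub>k(z)\<close> on the whole space.  Convergence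
  at one point \<open>l\<close> spreads by perturbation: if \<open>z\<close> lies in one of two resolvent sets and the
  resolvents are close enough at \<open>l\<close>, then \<open>z\<close> lies in the other one and the resolvents are
  close at \<open>z\<close>.  Used from \<open>T\<close> to \<open>T\<^sub>k\<close> and from \<open>T\<^sub>k\<close> to \<open>T\<close>, this shows that each point of the
  pseudospectrum of \<open>T\<close> eventually belongs to that of \<open>T\<^sub>k\<close>.  Conversely, outside the closed
  pseudospectrum of \<open>T\<close> the bound \<open>\<parallel>R(z)\<parallel> \<le> 1 / \<epsilon>\<close> is strict, by the maximum principle and the
  non-constancy of the norm, and therefore persists near \<open>z\<close> for all \<open>T\<^sub>k\<close> with \<open>k\<close> large.
  Compactness of \<open>K\<close> turns these two local statements into Hausdorff convergence.
\<close>

section \<open>Complex Hilbert spaces and orthogonal projections\<close>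

lemma scaleC_zero_left [simp]: "0 *\<^sub>C (x::'a::chilbert_space) = 0"
  using scaleC_of_real[of 0 x] by simp

lemma scaleC_minus_one: "(-1) *\<^sub>C (x::'a::chilbert_space) = - x"
  using scaleC_of_real[of "-1" x] by simp

lemma scaleC_zero_right [simp]: "a *\<^sub>C (0::'a::chilbert_space) = 0"
  using scaleC_add_right[of a "0::'a" 0] by simp

lemma scaleC_minus_right: "a *\<^sub>C (- x) = - (a *\<^sub>C (x::'a::chilbert_space))"
  using scaleC_add_right[of a x "-x"] by (simp add: eq_neg_iff_add_eq_0 add.commute)

lemma scaleC_minus_left: "(- a) *\<^sub>C x = - (a *\<^sub>C (x::'a::chilbert_space))"
  using scaleC_add_left[of a "-a" x] by (simp add: eq_neg_iff_add_eq_0 add.commute)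

lemma scaleC_diff_right: "a *\<^sub>C (x - y) = a *\<^sub>C x - a *\<^sub>C (y::'a::chilbert_space)"
  using scaleC_add_right[of a x "-y"] by (simp add: scaleC_minus_right)

lemma scaleC_diff_left: "(a - b) *\<^sub>C x = a *\<^sub>C x - b *\<^sub>C (x::'a::chilbert_space)"
  using scaleC_add_left[of a "-b" x] by (simp add: scaleC_minus_left)

lemma cinner_zero_right [simp]: "cinner x (0::'a::chilbert_space) = 0"
  using cinner_add_right[of x 0 0] by simp

lemma cinner_minus_right: "cinner x (- y) = - cinner x (y::'a::chilbert_space)"
  using cinner_add_right[of x y "-y"] by (simp add: eq_neg_iff_add_eq_0 add.commute)

lemma cinner_diff_right: "cinner x (y - z) = cinner x y - cinner x (z::'a::chilbert_space)"
  using cinner_add_right[of x y "-z"] by (simp add: cinner_minus_right)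

lemma cinner_scaleC_left: "cinner (a *\<^sub>C x) y = cnj a * cinner x (y::'a::chilbert_space)"
  by (metis cinner_commute cinner_scaleC_right complex_cnj_mult)

lemma cinner_self: "cinner x x = of_real ((norm (x::'a::chilbert_space))\<^sup>2)"
proof (rule complex_eqI)
  show "Re (cinner x x) = Re (of_real ((norm x)\<^sup>2))"
    by (simp add: Re_cinner power2_norm_eq_inner)
  have "Im (cinner x x) = - Im (cinner x x)"
    using arg_cong[OF cinner_commute[of x x], of Im] by simp
  then show "Im (cinner x x) = Im (of_real ((norm x)\<^sup>2))" by simp
qed

lemma norm_scaleC: "norm (a *\<^sub>C x) = cmod a * norm (x::'a::chilbert_space)"
proof -
  have "complex_of_real ((norm (a *\<^sub>C x))\<^sup>2) = a * cnj a * of_real ((norm x)\<^sup>2)"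
    by (metis cinner_scaleC_left cinner_scaleC_right cinner_self mult.assoc)
  also have "\<dots> = of_real ((cmod a * norm x)\<^sup>2)"
    by (simp add: complex_norm_square[symmetric] power_mult_distrib)
  finally have "(norm (a *\<^sub>C x))\<^sup>2 = (cmod a * norm x)\<^sup>2"
    using of_real_eq_iff by blast
  then show ?thesis by (simp add: power2_eq_iff_nonneg)
qed

lemma norm_cinner_le: "cmod (cinner x y) \<le> norm x * norm (y::'a::chilbert_space)"
proof -
  \<comment> \<open>Multiplication by \<open>a\<close> rotates \<open>cinner x y\<close> onto the
    nonnegative real axis, so the real Cauchy-Schwarz inequality applies. If
    \<open>cinner x y = 0\<close> then \<open>a = 0\<close>, hence only
    \<open>cmod a \<le> 1\<close> is used.\<close>
  define a where "a = cnj (sgn (cinner x y))"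
  have "a * cinner x y = of_real (cmod (cinner x y))"
    by (simp add: a_def sgn_eq complex_norm_square[symmetric] power2_eq_square mult.commute)
  then have "cmod (cinner x y) = inner x (a *\<^sub>C y)"
    by (metis Re_cinner Re_complex_of_real cinner_scaleC_right)
  also have "\<dots> \<le> norm x * norm (a *\<^sub>C y)" by (rule norm_cauchy_schwarz)
  also have "\<dots> \<le> norm x * norm y"
    by (intro mult_left_mono) (auto simp: norm_scaleC a_def norm_sgn)
  finally show ?thesis .
qed

lemma bounded_linear_cinner_right: "bounded_linear (\<lambda>x::'a::chilbert_space. cinner y x)"
proof (rule bounded_linear_intro)
  show "cinner y (r *\<^sub>R x) = r *\<^sub>R cinner y x" for r and x :: 'a
    by (simp add: scaleC_of_real[of r x, symmetric] cinner_scaleC_right scaleR_conv_of_real)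
  show "norm (cinner y x) \<le> norm x * norm y" for x :: 'a
    using norm_cinner_le[of y x] by (simp add: mult.commute)
qed (rule cinner_add_right)

section \<open>Closest points and orthogonal projections\<close>

lemma parallelogram_law:
  fixes a b :: "'a::real_inner"
  shows "(norm (a - b))\<^sup>2 + (norm (a + b))\<^sup>2 = 2 * (norm a)\<^sup>2 + 2 * (norm b)\<^sup>2"
  by (simp add: power2_norm_eq_inner inner_add_left inner_add_right inner_diff_left
      inner_diff_right inner_commute)

lemma csubspace_diff:
  assumes "closed_csubspace S" "x \<in> S" "y \<in> S"
  shows "x - y \<in> S"
proof -
  have "x + (-1) *\<^sub>C y \<in> S" using assms unfolding closed_csubspace_def by blast
  then show ?thesis by (simp add: scaleC_minus_one)
qed

lemma csubspace_scaleR: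
  assumes "closed_csubspace S" "x \<in> S"
  shows "r *\<^sub>R x \<in> S"
  using assms unfolding closed_csubspace_def by (metis scaleC_of_real)

text \<open>A minimising sequence is Cauchy by the parallelogram law, because midpoints of its
  members stay in \<open>S\<close> and cannot beat the infimum. Completeness and closedness of
  \<open>S\<close> supply the limit.\<close>

lemma closest_point_exists:
  fixes x :: "'a::chilbert_space"
  assumes S: "closed_csubspace S"
  obtains y where "y \<in> S" "\<And>h. h \<in> S \<Longrightarrow> norm (x - y) \<le> norm (x - h)"
proof -
  define d where "d = (INF y\<in>S. (norm (x - y))\<^sup>2)"
  have S0: "S \<noteq> {}" and cl: "closed S" and add: "\<And>u v. u \<in> S \<Longrightarrow> v \<in> S \<Longrightarrow> u + v \<in> S"
    using S unfolding closed_csubspace_def by auto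
  have bdd: "bdd_below ((\<lambda>y. (norm (x - y))\<^sup>2) ` S)" by (rule bdd_belowI[of _ 0]) auto
  have d_le: "d \<le> (norm (x - y))\<^sup>2" if "y \<in> S" for y
    unfolding d_def using bdd that by (rule cINF_lower)
  have "\<exists>y\<in>S. (norm (x - y))\<^sup>2 < d + inverse (real (Suc n))" for n
    using cINF_less_iff[OF S0 bdd, of "d + inverse (real (Suc n))"] unfolding d_def[symmetric]
    by simp
  then obtain Y where Y: "\<And>n. Y n \<in> S"
    "\<And>n. (norm (x - Y n))\<^sup>2 < d + inverse (real (Suc n))" by metis
  have YY: "(norm (Y m - Y n))\<^sup>2 \<le> 4 * inverse (real (Suc N))" if "N \<le> m" "N \<le> n" for m n N
  proof -
    have "(1/2) *\<^sub>R (Y m + Y n) \<in> S" using Y add S by (intro csubspace_scaleR) auto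
    then have "d \<le> (norm (x - (1/2) *\<^sub>R (Y m + Y n)))\<^sup>2" by (rule d_le)
    also have "x - (1/2) *\<^sub>R (Y m + Y n) = (1/2) *\<^sub>R ((x - Y n) + (x - Y m))"
      by (simp add: algebra_simps flip: scaleR_add_left)
    also have "(norm \<dots>)\<^sup>2 = (norm ((x - Y n) + (x - Y m)))\<^sup>2 / 4"
      by (simp add: power_divide)
    finally have "4 * d \<le> (norm ((x - Y n) + (x - Y m)))\<^sup>2" by simp
    moreover have "inverse (real (Suc m)) \<le> inverse (real (Suc N))"
      "inverse (real (Suc n)) \<le> inverse (real (Suc N))" using that by (simp_all add: le_imp_inverse_le)
    moreover note Y(2)[of m] Y(2)[of n] parallelogram_law[of "x - Y n" "x - Y m"]
    ultimately have "(norm ((x - Y n) - (x - Y m)))\<^sup>2 \<le> 4 * inverse (real (Suc N))" by linarith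
    then show ?thesis by simp
  qed
  have "Cauchy Y"
  proof (rule metric_CauchyI)
    fix e :: real assume "e > 0"
    then have "e\<^sup>2 / 4 > 0" by simp
    then obtain N where N: "inverse (real (Suc N)) < e\<^sup>2 / 4" using reals_Archimedean by blast
    have "dist (Y m) (Y n) < e" if "m \<ge> N" "n \<ge> N" for m n
    proof -
      have "(norm (Y m - Y n))\<^sup>2 < e\<^sup>2" using YY[OF that] N by simp
      then show ?thesis using \<open>e > 0\<close> by (simp add: dist_norm power_less_imp_less_base)
    qed
    then show "\<exists>M. \<forall>m\<ge>M. \<forall>n\<ge>M. dist (Y m) (Y n) < e" by blast
  qed
  then obtain y where y: "Y \<longlonglongrightarrow> y" using Cauchy_convergent_iff convergent_def by blast
  have "y \<in> S" using closed_sequentially[OF cl] Y(1) y by blast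
  have "(\<lambda>n. (norm (x - Y n))\<^sup>2) \<longlonglongrightarrow> (norm (x - y))\<^sup>2" by (intro tendsto_intros y)
  moreover have "(\<lambda>n. d + inverse (real (Suc n))) \<longlonglongrightarrow> d + 0"
    by (intro tendsto_intros LIMSEQ_inverse_real_of_nat)
  ultimately have "(norm (x - y))\<^sup>2 \<le> d + 0"
    by (rule LIMSEQ_le) (use Y(2) less_imp_le in blast)
  then have "norm (x - y) \<le> norm (x - h)" if "h \<in> S" for h
    using d_le[OF that] by (simp add: power2_le_imp_le)
  with \<open>y \<in> S\<close> show thesis by (rule that)
qed

lemma inner_eq_0_if_minimal:
  fixes v h :: "'a::real_inner"
  assumes "\<And>t. norm v \<le> norm (v - t *\<^sub>R h)"
  shows "inner h v = 0"
proof (cases "h = 0")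
  case False
  \<comment> \<open>The minimiser of the quadratic polynomial
    \<open>t \<mapsto> (norm (v - t *\<^sub>R h))\<^sup>2\<close>.\<close>
  define t where "t = inner h v / inner h h"
  have "(norm v)\<^sup>2 \<le> (norm (v - t *\<^sub>R h))\<^sup>2" using assms by (simp add: power_mono)
  also have "\<dots> = (norm v)\<^sup>2 - (inner h v)\<^sup>2 / inner h h"
    using False unfolding power2_norm_eq_inner t_def
    by (simp add: inner_diff_left inner_diff_right inner_commute power2_eq_square field_simps)
  finally have "(inner h v)\<^sup>2 / inner h h \<le> 0" by simp
  moreover have "inner h h > 0" using False by simp
  ultimately have "(inner h v)\<^sup>2 \<le> 0" by (simp add: divide_le_0_iff)
  then show ?thesis by simp
qed simp

lemma orth_proj_ex1:
  fixes x :: "'a::chilbert_space"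
  assumes S: "closed_csubspace S"
  shows "\<exists>!y. y \<in> S \<and> (\<forall>h\<in>S. cinner h (x - y) = 0)"
proof (rule ex_ex1I)
  obtain y where y: "y \<in> S" "\<And>h. h \<in> S \<Longrightarrow> norm (x - y) \<le> norm (x - h)"
    using closest_point_exists[OF S] by blast
  have Re0: "inner h (x - y) = 0" if "h \<in> S" for h
  proof (rule inner_eq_0_if_minimal)
    fix t
    have "y + t *\<^sub>R h \<in> S"
      using y that csubspace_scaleR[OF S] S unfolding closed_csubspace_def by blast
    from y(2)[OF this] show "norm (x - y) \<le> norm (x - y - t *\<^sub>R h)"
      by (simp add: algebra_simps)
  qed
  \<comment> \<open>Minimality along real lines controls only the real part; the imaginary part
    follows by testing with \<open>\<i> *\<^sub>C h\<close>, which also lies in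
    \<open>S\<close>.\<close>
  have "cinner h (x - y) = 0" if "h \<in> S" for h
  proof (rule complex_eqI)
    show "Re (cinner h (x - y)) = Re 0" using Re0[OF that] by (simp add: Re_cinner)
    have "\<i> *\<^sub>C h \<in> S" using that S unfolding closed_csubspace_def by blast
    then have "Re (cinner (\<i> *\<^sub>C h) (x - y)) = 0" using Re0 by (simp add: Re_cinner)
    then show "Im (cinner h (x - y)) = Im 0" by (simp add: cinner_scaleC_left)
  qed
  with y(1) show "\<exists>y. y \<in> S \<and> (\<forall>h\<in>S. cinner h (x - y) = 0)" by blast
next
  fix y y' assume *: "y \<in> S \<and> (\<forall>h\<in>S. cinner h (x - y) = 0)" "y' \<in> S \<and> (\<forall>h\<in>S. cinner h (x - y') = 0)"
  then have "y - y' \<in> S" using csubspace_diff[OF S] by blast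
  then have "cinner (y - y') (x - y') - cinner (y - y') (x - y) = 0" using * by simp
  then have "cinner (y - y') (y - y') = 0" by (simp flip: cinner_diff_right)
  then show "y = y'" by (simp add: cinner_self)
qed

lemma orth_proj_in: "closed_csubspace S \<Longrightarrow> orth_proj S x \<in> S"
  and cinner_orth_proj: "closed_csubspace S \<Longrightarrow> h \<in> S \<Longrightarrow> cinner h (x - orth_proj S x) = 0"
  using theI'[OF orth_proj_ex1, of S x] unfolding orth_proj_def by blast+

lemma orth_proj_eqI:
  assumes "closed_csubspace S" "y \<in> S" "\<And>h. h \<in> S \<Longrightarrow> cinner h (x - y) = 0"
  shows "orth_proj S x = y"
  using orth_proj_ex1[OF assms(1), of x] orth_proj_in[OF assms(1), of x]
    cinner_orth_proj[OF assms(1)] assms by blast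

lemma orth_proj_id: "closed_csubspace S \<Longrightarrow> x \<in> S \<Longrightarrow> orth_proj S x = x"
  by (rule orth_proj_eqI) auto

lemma orth_proj_add:
  assumes "closed_csubspace S"
  shows "orth_proj S (x + y) = orth_proj S x + orth_proj S y"
proof (rule orth_proj_eqI[OF assms])
  show "orth_proj S x + orth_proj S y \<in> S"
    using assms orth_proj_in[OF assms] unfolding closed_csubspace_def by blast
  fix h assume "h \<in> S"
  then show "cinner h (x + y - (orth_proj S x + orth_proj S y)) = 0"
    using cinner_orth_proj[OF assms, of h x] cinner_orth_proj[OF assms, of h y]
    by (simp add: cinner_diff_right cinner_add_right)
qed

lemma orth_proj_scaleC:
  assumes "closed_csubspace S"
  shows "orth_proj S (a *\<^sub>C x) = a *\<^sub>C orth_proj S x"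
proof (rule orth_proj_eqI[OF assms])
  show "a *\<^sub>C orth_proj S x \<in> S"
    using assms orth_proj_in[OF assms] unfolding closed_csubspace_def by blast
  fix h assume "h \<in> S"
  then show "cinner h (a *\<^sub>C x - a *\<^sub>C orth_proj S x) = 0"
    using cinner_orth_proj[OF assms, of h x]
    by (simp add: cinner_scaleC_right flip: scaleC_diff_right)
qed

text \<open>The projection \<open>p\<close> of \<open>x\<close> is orthogonal to
  \<open>x - p\<close>, so its squared norm is \<open>cinner p x\<close>; Cauchy-Schwarz then allows
  one factor to be cancelled.\<close>

lemma norm_orth_proj_le:
  assumes "closed_csubspace S"
  shows "norm (orth_proj S x) \<le> norm x"
proof -
  let ?p = "orth_proj S x"
  have "cinner ?p x = cinner ?p ?p"
    using cinner_orth_proj[OF assms orth_proj_in[OF assms], of x x] by (simp add: cinner_diff_right)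
  then have "(norm ?p)\<^sup>2 = cmod (cinner ?p x)" by (simp add: cinner_self norm_power)
  also have "\<dots> \<le> norm ?p * norm x" by (rule norm_cinner_le)
  finally show ?thesis
    by (cases "norm ?p = 0") (auto simp: power2_eq_square)
qed

section \<open>Resolvents as operators on the ambient space\<close>

text \<open>Solving \<open>y - f y = g\<close> means finding a fixed point of the contraction
  \<open>y \<mapsto> g + f y\<close>. The lower estimate bounds the inverse by
  \<open>1 / (1 - q)\<close>. This takes the place of the Neumann series.\<close>

lemma bij_id_minus_contraction:
  fixes f :: "'a::banach \<Rightarrow> 'a"
  assumes f: "\<And>x y. f (x - y) = f x - f y" "\<And>x. norm (f x) \<le> q * norm x" and q: "q < 1"
  shows "bij (\<lambda>y. y - f y)" and "(1 - q) * norm y \<le> norm (y - f y)"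
proof -
  show "(1 - q) * norm y \<le> norm (y - f y)"
    using norm_triangle_ineq2[of y "f y"] f(2)[of y] by (simp add: algebra_simps)
  \<comment> \<open>Banach's fixed point theorem asks for a nonnegative constant, whereas
    \<open>q\<close> comes without a sign.\<close>
  have bound: "norm (f x) \<le> max q 0 * norm x" for x
    using f(2)[of x] by (meson max.cobounded1 mult_right_mono norm_ge_zero order_trans)
  have "\<exists>!y. g + f y = y" for g
  proof (rule banach_fix_type[of "max q 0"])
    show "\<forall>x y. dist (g + f x) (g + f y) \<le> max q 0 * dist x y"
      using bound by (simp add: dist_norm flip: f(1))
  qed (use q in auto)
  then have "\<exists>!y. y - f y = g" for g by (simp add: algebra_simps eq_commute)
  then show "bij (\<lambda>y. y - f y)" by (simp add: bij_iff eq_commute)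
qed

section \<open>Resolvents of a single operator\<close>

locale hilbert_operator =
  fixes H :: "'a::chilbert_space set" and T :: "'a operator"
  assumes csubspace: "closed_csubspace H" and linear_op: "linear_operator_in H T"
begin

text \<open>Precomposition with the projection puts resolvents acting in different subspaces into
  one normed space, where they can be subtracted. \<open>Blinfun\<close> returns the intended map
  only for bounded linear arguments, so \<open>R z\<close> is meaningful for \<open>z\<close> in the
  resolvent set.\<close>

definition R :: "complex \<Rightarrow> 'a \<Rightarrow>\<^sub>L 'a" where
  "R z = Blinfun (\<lambda>x. resolvent T z (orth_proj H x))"

lemma dom_subset: "x \<in> op_dom T \<Longrightarrow> x \<in> H"
  using linear_op unfolding linear_operator_in_def by blast

lemma dom_scaleC: "x \<in> op_dom T \<Longrightarrow> c *\<^sub>C x \<in> op_dom T"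
  and dom_add: "x \<in> op_dom T \<Longrightarrow> y \<in> op_dom T \<Longrightarrow> x + y \<in> op_dom T"
  using linear_op unfolding linear_operator_in_def by blast+

lemma op_shift_add:
  "x \<in> op_dom T \<Longrightarrow> y \<in> op_dom T \<Longrightarrow> op_shift T z (x + y) = op_shift T z x + op_shift T z y"
  using linear_op unfolding linear_operator_in_def op_shift_def by (simp add: scaleC_add_right)

lemma op_shift_scaleC: "x \<in> op_dom T \<Longrightarrow> op_shift T z (c *\<^sub>C x) = c *\<^sub>C op_shift T z x"
  using linear_op unfolding linear_operator_in_def op_shift_def
  by (simp add: scaleC_diff_right scaleC_scaleC mult.commute)

context
  fixes z assumes z: "z \<in> resolvent_set H T"
begin

lemma op_shift_bij: "bij_betw (op_shift T z) (op_dom T) H"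
  using z unfolding resolvent_set_def by blast

lemma resolvent_in_dom: "y \<in> H \<Longrightarrow> resolvent T z y \<in> op_dom T"
  using op_shift_bij unfolding resolvent_def by (metis bij_betw_def inv_into_into)

lemma op_shift_resolvent: "y \<in> H \<Longrightarrow> op_shift T z (resolvent T z y) = y"
  using op_shift_bij unfolding resolvent_def by (simp add: bij_betw_inv_into_right)

lemma resolvent_op_shift: "x \<in> op_dom T \<Longrightarrow> resolvent T z (op_shift T z x) = x"
  using op_shift_bij unfolding resolvent_def by (simp add: bij_betw_inv_into_left)

lemma op_shift_in: "x \<in> op_dom T \<Longrightarrow> op_shift T z x \<in> H"
  using op_shift_bij by (rule bij_betw_apply)

lemma resolvent_add:
  assumes "x \<in> H" "y \<in> H"
  shows "resolvent T z (x + y) = resolvent T z x + resolvent T z y"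
proof -
  have "op_shift T z (resolvent T z x + resolvent T z y) = x + y"
    using assms by (simp add: op_shift_add resolvent_in_dom op_shift_resolvent)
  then show ?thesis
    using resolvent_op_shift[of "resolvent T z x + resolvent T z y"] assms
    by (simp add: dom_add resolvent_in_dom)
qed

lemma resolvent_scaleC:
  assumes "x \<in> H"
  shows "resolvent T z (c *\<^sub>C x) = c *\<^sub>C resolvent T z x"
proof -
  have "op_shift T z (c *\<^sub>C resolvent T z x) = c *\<^sub>C x"
    using assms by (simp add: op_shift_scaleC resolvent_in_dom op_shift_resolvent)
  then show ?thesis
    using resolvent_op_shift[of "c *\<^sub>C resolvent T z x"] assms
    by (simp add: dom_scaleC resolvent_in_dom)
qed

lemma bounded_linear_resolvent_proj: "bounded_linear (\<lambda>x. resolvent T z (orth_proj H x))"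
proof -
  have [simp]: "orth_proj H x \<in> H" for x by (rule orth_proj_in[OF csubspace])
  obtain C where "\<forall>y\<in>H. norm (resolvent T z y) \<le> C * norm y"
    using z unfolding resolvent_set_def by blast
  \<comment> \<open>The constant in \<open>resolvent_set\<close> may be negative (when
    \<open>H\<close> is trivial), hence the absolute value.\<close>
  then have C: "norm (resolvent T z (orth_proj H x)) \<le> \<bar>C\<bar> * norm (orth_proj H x)" for x
    using mult_right_mono[OF abs_ge_self norm_ge_zero] by (meson \<open>orth_proj H x \<in> H\<close> order_trans)
  show ?thesis
  proof (rule bounded_linear_intro)
    fix x y and r :: real
    show "resolvent T z (orth_proj H (x + y)) = resolvent T z (orth_proj H x) + resolvent T z (orth_proj H y)"
      by (simp add: orth_proj_add[OF csubspace] resolvent_add)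
    show "resolvent T z (orth_proj H (r *\<^sub>R x)) = r *\<^sub>R resolvent T z (orth_proj H x)"
      by (simp add: scaleC_of_real[symmetric] orth_proj_scaleC[OF csubspace] resolvent_scaleC)
    show "norm (resolvent T z (orth_proj H x)) \<le> norm x * \<bar>C\<bar>"
      using C[of x] norm_orth_proj_le[OF csubspace, of x]
      by (metis abs_ge_zero mult.commute mult_left_mono order_trans)
  qed
qed

lemma R_apply: "R z x = resolvent T z (orth_proj H x)"
  unfolding R_def by (simp add: bounded_linear_Blinfun_apply bounded_linear_resolvent_proj)

lemma R_apply_in: "x \<in> H \<Longrightarrow> R z x = resolvent T z x"
  by (simp add: R_apply orth_proj_id[OF csubspace])

lemma R_in_dom: "R z x \<in> op_dom T"
  by (simp add: R_apply resolvent_in_dom orth_proj_in[OF csubspace])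

lemma R_scaleC: "R z (c *\<^sub>C x) = c *\<^sub>C R z x"
  by (simp add: R_apply orth_proj_scaleC[OF csubspace] resolvent_scaleC orth_proj_in[OF csubspace])

text \<open>The projection is the identity on \<open>H\<close> and does not increase norms, so
  composing with it preserves the operator norm.\<close>

lemma onorm_on_resolvent: "onorm_on H (resolvent T z) = norm (R z)"
proof (rule antisym)
  have le: "norm (resolvent T z x) / norm x \<le> norm (R z)" if "x \<in> H" for x
    using norm_blinfun[of "R z" x] that by (cases "x = 0") (auto simp: R_apply_in field_simps)
  have "0 \<in> H" using csubspace unfolding closed_csubspace_def by blast
  then show "onorm_on H (resolvent T z) \<le> norm (R z)"
    unfolding onorm_on_def by (intro cSUP_least le) auto
  have bdd: "bdd_above ((\<lambda>x. norm (resolvent T z x) / norm x) ` H)"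
    using le by (intro bdd_aboveI2)
  have upper: "norm (resolvent T z x) / norm x \<le> onorm_on H (resolvent T z)" if "x \<in> H" for x
    unfolding onorm_on_def using that bdd by (rule cSUP_upper)
  \<comment> \<open>Division by zero makes the quotient at \<open>0\<close> equal to
    \<open>0\<close>, so the supremum is nonnegative even if \<open>H = {0}\<close>.\<close>
  have nonneg: "0 \<le> onorm_on H (resolvent T z)" using upper[OF \<open>0 \<in> H\<close>] by simp
  show "norm (R z) \<le> onorm_on H (resolvent T z)"
  proof (rule norm_blinfun_bound[OF nonneg])
    fix x
    let ?p = "orth_proj H x"
    have p: "?p \<in> H" by (rule orth_proj_in[OF csubspace])
    have "norm (R z ?p) \<le> onorm_on H (resolvent T z) * norm ?p"
      using upper[OF p] p by (cases "?p = 0") (auto simp: R_apply_in field_simps)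
    also have "\<dots> \<le> onorm_on H (resolvent T z) * norm x"
      using nonneg norm_orth_proj_le[OF csubspace] by (intro mult_left_mono)
    also have "R z ?p = R z x" by (simp add: R_apply orth_proj_id[OF csubspace p])
    finally show "norm (R z x) \<le> onorm_on H (resolvent T z) * norm x" .
  qed
qed

lemma resolvent_norm_eq: "resolvent_norm H T z = ereal (norm (R z))"
  using z by (simp add: resolvent_norm_def spectrum_def onorm_on_resolvent)

text \<open>On the domain, \<open>T - w = (I - (w - z) R(z)) (T - z)\<close>. Bijectivity of the
  first factor therefore passes to \<open>T - w\<close>, and its lower bound makes the inverse
  bounded.\<close>

lemma resolvent_setI:
  assumes bij: "bij (\<lambda>y. y - (w - z) *\<^sub>C R z y)"
    and bound: "\<And>y. norm y \<le> c * norm (y - (w - z) *\<^sub>C R z y)"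
  shows "w \<in> resolvent_set H T"
proof -
  define M where "M y = y - (w - z) *\<^sub>C R z y" for y
  have bijM: "bij M" using bij unfolding M_def .
  \<comment> \<open>\<open>M\<close> changes its argument by an element of \<open>H\<close>, so this
    bijection of the ambient space restricts to a bijection of \<open>H\<close>.\<close>
  have M_in: "M y \<in> H \<longleftrightarrow> y \<in> H" for y
  proof -
    have "(w - z) *\<^sub>C R z y \<in> H"
      using dom_subset[OF R_in_dom] csubspace unfolding closed_csubspace_def by blast
    then show ?thesis
      using csubspace_diff[OF csubspace] csubspace unfolding M_def closed_csubspace_def
      by (metis diff_add_cancel)
  qed
  have "M ` H = H"
  proof
    show "H \<subseteq> M ` H" using M_in bijM by (metis bij_pointE image_iff subsetI)
  qed (use M_in in auto)
  then have bijMH: "bij_betw M H H"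
    using bijM by (metis bij_betw_subset bij_def bij_betw_def inj_on_subset subset_UNIV)
  have shift: "op_shift T w x = M (op_shift T z x)" if "x \<in> op_dom T" for x
    using that
    by (simp add: M_def R_apply_in op_shift_in resolvent_op_shift)
       (simp add: op_shift_def scaleC_diff_left)
  have "bij_betw (M \<circ> op_shift T z) (op_dom T) H"
    using op_shift_bij bijMH by (rule bij_betw_trans)
  then have bw: "bij_betw (op_shift T w) (op_dom T) H"
    by (rule bij_betw_cong[THEN iffD1, rotated]) (simp add: shift)
  have "norm (resolvent T w y) \<le> (norm (R z) * c) * norm y" if "y \<in> H" for y
  proof -
    let ?x = "resolvent T w y"
    have x: "?x \<in> op_dom T" "op_shift T w ?x = y"
      using bw that unfolding resolvent_def
      by (metis bij_betw_def inv_into_into, simp add: bij_betw_inv_into_right)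
    have "norm ?x = norm (R z (op_shift T z ?x))"
      using x by (simp add: R_apply_in op_shift_in resolvent_op_shift)
    also have "\<dots> \<le> norm (R z) * norm (op_shift T z ?x)" by (rule norm_blinfun)
    also have "\<dots> \<le> norm (R z) * (c * norm y)"
      using bound[of "op_shift T z ?x"] shift[OF x(1)] x(2)
      by (intro mult_left_mono) (auto simp: M_def)
    finally show ?thesis by (simp add: mult.assoc)
  qed
  with bw show ?thesis unfolding resolvent_set_def by blast
qed

end

text \<open>The first resolvent identity. Applying \<open>T - z\<close> to \<open>a = R(w) x\<close>
  gives the projection of \<open>x\<close> minus \<open>(z - w) a\<close>; it remains to apply
  \<open>R(z)\<close>.\<close>

lemma resolvent_identity:
  assumes z: "z \<in> resolvent_set H T" and w: "w \<in> resolvent_set H T"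
  shows "R z x - R w x = (z - w) *\<^sub>C R z (R w x)"
proof -
  let ?u = "orth_proj H x"
  let ?a = "resolvent T w ?u"
  have u: "?u \<in> H" by (rule orth_proj_in[OF csubspace])
  have a: "?a \<in> op_dom T" by (rule resolvent_in_dom[OF w u])
  have aH: "?a \<in> H" by (rule dom_subset[OF a])
  have "op_shift T z ?a = ?u - (z - w) *\<^sub>C ?a"
    using op_shift_resolvent[OF w u] by (simp add: op_shift_def scaleC_diff_left algebra_simps)
  then have "?a = R z (?u - (z - w) *\<^sub>C ?a)"
    using resolvent_op_shift[OF z a] R_apply_in[OF z op_shift_in[OF z a]] by simp
  also have "\<dots> = R z ?u - (z - w) *\<^sub>C R z ?a"
    by (simp add: blinfun.diff_right R_scaleC[OF z])
  finally show ?thesis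
    by (simp add: R_apply[OF z] R_apply[OF w] orth_proj_id[OF csubspace] u aH algebra_simps)
qed

lemma norm_R_diff_le:
  assumes z: "z \<in> resolvent_set H T" and w: "w \<in> resolvent_set H T"
  shows "norm (R z - R w) \<le> cmod (z - w) * norm (R z) * norm (R w)"
proof (rule norm_blinfun_bound)
  fix x
  have "norm ((R z - R w) x) = cmod (z - w) * norm (R z (R w x))"
    by (simp add: blinfun.diff_left resolvent_identity[OF z w] norm_scaleC)
  also have "\<dots> \<le> cmod (z - w) * (norm (R z) * (norm (R w) * norm x))"
    by (meson mult_left_mono norm_blinfun norm_ge_zero order_trans)
  finally show "norm ((R z - R w) x) \<le> cmod (z - w) * norm (R z) * norm (R w) * norm x"
    by (simp add: mult.assoc)
qed simp

text \<open>The smallness condition makes \<open>I - (w - z) R(z)\<close> invertible. The norm bound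
  comes from estimating \<open>R(w) - R(z)\<close> by the resolvent identity and collecting the
  terms with \<open>norm (R w)\<close>.\<close>

lemma resolvent_near:
  assumes z: "z \<in> resolvent_set H T" and less: "cmod (w - z) * norm (R z) < 1"
  shows "w \<in> resolvent_set H T"
    and "norm (R w) * (1 - cmod (w - z) * norm (R z)) \<le> norm (R z)"
proof -
  let ?q = "cmod (w - z) * norm (R z)"
  let ?f = "\<lambda>y. (w - z) *\<^sub>C R z y"
  have 1: "?f (x - y) = ?f x - ?f y" for x y
    by (simp add: blinfun.diff_right scaleC_diff_right)
  have 2: "norm (?f x) \<le> ?q * norm x" for x
    using norm_blinfun[of "R z" x] by (simp add: norm_scaleC mult_left_mono mult.assoc)
  note c = bij_id_minus_contraction[of ?f, OF 1 2 less]
  show w: "w \<in> resolvent_set H T"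
  proof (rule resolvent_setI[OF z c(1)])
    fix y show "norm y \<le> inverse (1 - ?q) * norm (y - ?f y)"
      using c(2)[of y] less by (simp add: field_simps)
  qed
  have "norm (R w) \<le> norm (R z) + norm (R w - R z)"
    by (metis add.commute diff_add_cancel norm_triangle_ineq)
  also have "norm (R w - R z) \<le> cmod (w - z) * norm (R w) * norm (R z)"
    by (rule norm_R_diff_le[OF w z])
  finally show "norm (R w) * (1 - ?q) \<le> norm (R z)" by (simp add: algebra_simps)
qed

lemma open_resolvent_set: "open (resolvent_set H T)"
proof (rule openI)
  fix z assume z: "z \<in> resolvent_set H T"
  \<comment> \<open>The summand \<open>1\<close> keeps the denominator positive when
    \<open>R z = 0\<close>.\<close>
  define d where "d = 1 / (norm (R z) + 1)"
  have "d > 0" by (simp add: d_def add_nonneg_pos)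
  moreover have "ball z d \<subseteq> resolvent_set H T"
  proof
    fix w assume "w \<in> ball z d"
    then have "cmod (w - z) < d" by (simp add: dist_norm norm_minus_commute)
    then have "cmod (w - z) * (norm (R z) + 1) < 1"
      by (simp add: d_def pos_less_divide_eq add_nonneg_pos)
    then have "cmod (w - z) * norm (R z) < 1"
      using norm_ge_zero[of "w - z"] by (simp add: algebra_simps del: norm_ge_zero)
    then show "w \<in> resolvent_set H T" by (rule resolvent_near(1)[OF z])
  qed
  ultimately show "\<exists>T'>0. ball z T' \<subseteq> resolvent_set H T" by blast
qed

text \<open>Close to \<open>z\<close> the norm of \<open>R w\<close> is at most
  \<open>2 * b\<close>, and the resolvent identity turns this bound into a Lipschitz estimate at
  \<open>z\<close>.\<close>

lemma isCont_R:
  assumes z: "z \<in> resolvent_set H T"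
  shows "isCont R z"
proof -
  define b where "b = norm (R z)"
  have lim: "((\<lambda>w. cmod (w - z) * b) \<longlongrightarrow> 0) (at z)" by (auto intro!: tendsto_eq_intros)
  have lim2: "((\<lambda>w. cmod (w - z) * (2 * b) * b) \<longlongrightarrow> 0) (at z)" by (auto intro!: tendsto_eq_intros)
  have "\<forall>\<^sub>F w in at z. cmod (w - z) * b < 1/2" by (rule order_tendstoD(2)[OF lim]) simp
  then have "\<forall>\<^sub>F w in at z. norm (R w - R z) \<le> cmod (w - z) * (2 * b) * b"
  proof eventually_elim
    case (elim w)
    have less: "cmod (w - z) * norm (R z) < 1" using elim by (simp add: b_def)
    have "norm (R w) * (1/2) \<le> norm (R w) * (1 - cmod (w - z) * b)"
      using elim by (intro mult_left_mono) auto
    with resolvent_near(2)[OF z less] have "norm (R w) \<le> 2 * b" by (simp add: b_def)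
    with norm_R_diff_le[OF resolvent_near(1)[OF z less] z] show ?case
      by (smt (verit, best) b_def mult_left_mono mult_right_mono norm_ge_zero)
  qed
  then have "((\<lambda>w. R w - R z) \<longlongrightarrow> 0) (at z)" by (rule Lim_null_comparison[OF _ lim2])
  then show ?thesis by (simp add: isCont_def LIM_zero_iff)
qed

end

section \<open>Maximum principle and perturbation of resolvents\<close>

text \<open>Cauchy's integral formula at the centre: the derivative of the circle path is
  \<open>2 * pi * \<i>\<close> times its displacement from \<open>z\<close>, which cancels the
  denominator.\<close>

lemma circle_mean_value:
  assumes f: "f holomorphic_on cball z r" and r: "r > 0"
  shows "((\<lambda>t. f (circlepath z r t)) has_integral f z) {0..1}"
proof -
  have "((\<lambda>u. f u / (u - z)) has_contour_integral (2 * of_real pi * \<i> * f z)) (circlepath z r)"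
    using f r by (intro Cauchy_integral_circlepath_simple) auto
  then have "((\<lambda>t. f (circlepath z r t) / (circlepath z r t - z) *
      vector_derivative (circlepath z r) (at t within {0..1})) has_integral
      (2 * of_real pi * \<i> * f z)) {0..1}"
    by (simp add: has_contour_integral_def)
  then have "((\<lambda>t. (2 * of_real pi * \<i>) * f (circlepath z r t)) has_integral
      (2 * of_real pi * \<i>) * f z) {0..1}"
    by (rule has_integral_eq[rotated])
       (use r in \<open>simp add: vector_derivative_circlepath01 circlepath[THEN fun_cong]\<close>)
  from has_integral_mult_right[OF this, of "inverse (2 * of_real pi * \<i>)"] show ?thesis
    by (simp add: field_simps)
qed

section \<open>The maximum principle for the resolvent norm\<close>

context hilbert_operator
begin

text \<open>By the resolvent identity the difference quotient equals
  \<open>cinner y (R v (R w x))\<close>, which converges because \<open>R\<close> is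
  continuous.\<close>

lemma holomorphic_cinner_R: "(\<lambda>w. cinner y (R w x)) holomorphic_on resolvent_set H T"
  unfolding holomorphic_on_open[OF open_resolvent_set]
proof (intro ballI exI)
  fix w assume w: "w \<in> resolvent_set H T"
  have "((\<lambda>v. cinner y (R v (R w x))) \<longlongrightarrow> cinner y (R w (R w x))) (at w)"
    using isCont_R[OF w] unfolding isCont_def
    by (intro bounded_linear.tendsto[OF bounded_linear_cinner_right] blinfun.tendsto tendsto_const)
  moreover have "\<forall>\<^sub>F v in at w. v \<in> resolvent_set H T \<and> v \<noteq> w"
    using eventually_at_in_open[OF open_resolvent_set w] by (simp add: eventually_at_filter)
  then have "\<forall>\<^sub>F v in at w. cinner y (R v (R w x)) = (cinner y (R v x) - cinner y (R w x)) / (v - w)"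
  proof eventually_elim
    case (elim v)
    then have "cinner y (R v x) - cinner y (R w x) = (v - w) * cinner y (R v (R w x))"
      using resolvent_identity[of v w x] w
      by (simp flip: cinner_diff_right cinner_scaleC_right)
    with elim show ?case by simp
  qed
  ultimately show "((\<lambda>w. cinner y (R w x)) has_field_derivative cinner y (R w (R w x))) (at w)"
    unfolding has_field_derivative_iff by (rule Lim_transform_eventually)
qed

text \<open>
  The norm has the sub-mean-value property because \<open>\<parallel>R(z) x\<parallel>\<^sup>2\<close> is the value at \<open>z\<close> of the
  holomorphic function \<open>w \<mapsto> \<langle>R(z) x, R(w) x\<rangle>\<close>.
\<close>

lemma norm_R_less:
  assumes r: "r > 0" and sub: "ball z r \<subseteq> resolvent_set H T"
    and le: "\<And>w. w \<in> ball z r \<Longrightarrow> norm (R w) \<le> M"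
    and nonconst: "\<not> (\<lambda>w. norm (R w)) constant_on ball z r"
  shows "norm (R z) < M"
proof (rule ccontr)
  assume "\<not> norm (R z) < M"
  with le[of z] r have M: "norm (R z) = M" by simp
  have "norm (R w) = M" if w: "w \<in> ball z r" for w
  proof (cases "w = z")
    case False
    \<comment> \<open>The circle about \<open>z\<close> through \<open>w\<close>: if the norm is
      maximal at \<open>z\<close>, it is constant on this circle.\<close>
    define s where "s = dist z w"
    have s: "s > 0" "s < r" using w False by (simp_all add: s_def)
    have cball: "cball z s \<subseteq> ball z r" using s by auto
    have on_sphere: "circlepath z s t \<in> ball z r" if "t \<in> {0..1}" for t
    proof -
      have "circlepath z s t \<in> path_image (circlepath z s)" using that by (simp add: path_image_def)
      then show ?thesis using s by auto
    qed
    define g where "g t = norm (R (circlepath z s t))" for t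
    have "continuous_on (resolvent_set H T) R"
      by (simp add: continuous_at_imp_continuous_on isCont_R)
    moreover have "continuous_on {0..1} (circlepath z s)"
      using path_circlepath unfolding path_def by blast
    moreover have "circlepath z s ` {0..1} \<subseteq> resolvent_set H T"
      using on_sphere sub by blast
    ultimately have "continuous_on {0..1} (\<lambda>t. R (circlepath z s t))"
      by (rule continuous_on_compose2)
    then have g: "continuous_on {0..1} g" unfolding g_def by (rule continuous_on_norm)
    have int_g: "g integrable_on {0..1}" by (rule integrable_continuous_real[OF g])
    define I where "I = integral {0..1} g"
    have "0 \<le> I" unfolding I_def by (rule integral_nonneg[OF int_g]) (simp add: g_def)
    have "M \<le> I" unfolding M[symmetric]
    proof (rule norm_blinfun_bound[OF \<open>0 \<le> I\<close>])
      fix x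
      define y where "y = R z x"
      have "((\<lambda>t. cinner y (R (circlepath z s t) x)) has_integral cinner y (R z x)) {0..1}"
        using cball sub s(1)
        by (intro circle_mean_value holomorphic_on_subset[OF holomorphic_cinner_R]) auto
      moreover have "((\<lambda>t. (norm y * norm x) * g t) has_integral (norm y * norm x) * I) {0..1}"
        unfolding I_def by (intro has_integral_mult_right integrable_integral int_g)
      moreover have "cmod (cinner y (R (circlepath z s t) x)) \<le> (norm y * norm x) * g t" for t
      proof -
        have "cmod (cinner y (R (circlepath z s t) x)) \<le> norm y * norm (R (circlepath z s t) x)"
          by (rule norm_cinner_le)
        also have "\<dots> \<le> norm y * (g t * norm x)"
          unfolding g_def by (intro mult_left_mono norm_blinfun) simp
        finally show ?thesis by (simp add: mult_ac)
      qed
      ultimately have "cmod (cinner y (R z x)) \<le> (norm y * norm x) * I"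
        using integral_norm_bound_integral[of "\<lambda>t. cinner y (R (circlepath z s t) x)" "{0..1}"
            "\<lambda>t. (norm y * norm x) * g t"]
        by (simp add: has_integral_iff I_def)
      then have "norm y * norm y \<le> norm y * (I * norm x)"
        by (simp add: y_def[symmetric] cinner_self norm_mult power2_eq_square mult_ac)
      then show "norm (R z x) \<le> I * norm x"
        using \<open>0 \<le> I\<close> unfolding y_def[symmetric] by (cases "y = 0") auto
    qed
    have g_le: "g t \<le> M" if "t \<in> {0..1}" for t
      unfolding g_def by (intro le on_sphere that)
    \<comment> \<open>The continuous function \<open>M - g\<close> is nonnegative and has integral
      \<open>0\<close>, so it vanishes at every point of the circle, in particular at
      \<open>w\<close>.\<close>
    have "integral {0..1} (\<lambda>t. M - g t) = M - I"
      unfolding I_def using int_g by (subst integral_diff) auto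
    moreover have "0 \<le> integral {0..1} (\<lambda>t. M - g t)"
      using g_le int_g by (intro integral_nonneg integrable_diff) auto
    ultimately have "integral {0..1} (\<lambda>t. M - g t) = 0" using \<open>M \<le> I\<close> by simp
    then have gM: "\<forall>t\<in>{0..1}. M - g t = 0"
      using g g_le by (subst (asm) integral_eq_0_iff) (auto intro!: continuous_intros)
    have "w \<in> path_image (circlepath z s)" using s by (simp add: s_def)
    then obtain t where "t \<in> {0..1}" "circlepath z s t = w" unfolding path_image_def by blast
    with gM show ?thesis by (auto simp: g_def)
  qed (simp add: M)
  with nonconst show False unfolding constant_on_def by blast
qed

lemma pseudospectrum_iff:
  "z \<in> pseudospectrum H T \<epsilon> \<longleftrightarrow> z \<notin> resolvent_set H T \<or> norm (R z) > 1 / \<epsilon>"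
  by (cases "z \<in> resolvent_set H T")
     (simp_all add: pseudospectrum_def resolvent_norm_eq, simp add: resolvent_norm_def spectrum_def)

end

section \<open>Comparison of the resolvents of two operators\<close>

locale hilbert_operator_pair =
  S: hilbert_operator H\<^sub>S S + T: hilbert_operator H\<^sub>T T
  for H\<^sub>S :: "'a::chilbert_space set" and S :: "'a operator"
    and H\<^sub>T :: "'a set" and T :: "'a operator"
begin

text \<open>
  With \<open>\<mu> = z - l\<close>, the operator \<open>I - \<mu> (S - l)\<^sup>-\<^sup>1\<close> has the inverse \<open>N = I + \<mu> (S - z)\<^sup>-\<^sup>1\<close>, and
  \<open>I - \<mu> (T - l)\<^sup>-\<^sup>1\<close> differs from it by a small perturbation.
\<close>

lemma resolvent_perturbation:
  assumes l: "l \<in> resolvent_set H\<^sub>S S" "l \<in> resolvent_set H\<^sub>T T"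
    and z: "z \<in> resolvent_set H\<^sub>S S"
    and b: "norm (S.R z) \<le> b"
  defines "n \<equiv> 1 + cmod (z - l) * b" and "\<delta> \<equiv> norm (T.R l - S.R l)"
  assumes small: "cmod (z - l) * n * \<delta> < 1"
  shows "z \<in> resolvent_set H\<^sub>T T"
    and "norm (T.R z - S.R z) * (1 - cmod (z - l) * n * \<delta>) \<le> n\<^sup>2 * \<delta>"
proof -
  define \<mu> where "\<mu> = z - l"
  define D where "D = T.R l - S.R l"
  define N where "N v = v + \<mu> *\<^sub>C S.R z v" for v
  define M where "M y = y - \<mu> *\<^sub>C S.R l y" for y
  have b0: "b \<ge> 0" using b norm_ge_zero order_trans by blast
  have n1: "n \<ge> 1" using b0 by (simp add: n_def)
  have N_norm: "norm (N v) \<le> n * norm v" for v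
  proof -
    have "norm (S.R z v) \<le> b * norm v"
      using norm_blinfun[of "S.R z" v] b by (meson mult_right_mono norm_ge_zero order_trans)
    then have "cmod \<mu> * norm (S.R z v) \<le> cmod \<mu> * (b * norm v)" by (rule mult_left_mono) simp
    moreover have "norm (N v) \<le> norm v + cmod \<mu> * norm (S.R z v)"
      unfolding N_def by (metis norm_triangle_ineq norm_scaleC)
    ultimately show ?thesis by (simp add: n_def \<mu>_def algebra_simps)
  qed
  have N_diff: "N (x - y) = N x - N y" for x y
    by (simp add: N_def blinfun.diff_right scaleC_diff_right)
  have N_scaleC: "N (c *\<^sub>C x) = c *\<^sub>C N x" for c x
    by (simp add: N_def S.R_scaleC[OF z] scaleC_add_right scaleC_scaleC mult.commute)
  have MN: "M (N v) = v" for v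
  proof -
    have "S.R z v = S.R l v + \<mu> *\<^sub>C S.R l (S.R z v)"
      using S.resolvent_identity[OF l(1) z, of v] scaleC_minus_left[of \<mu> "S.R l (S.R z v)"]
      by (simp add: \<mu>_def algebra_simps)
    then have "\<mu> *\<^sub>C S.R z v = \<mu> *\<^sub>C S.R l v + \<mu> *\<^sub>C \<mu> *\<^sub>C S.R l (S.R z v)"
      by (metis scaleC_add_right)
    moreover have "M (N v) = v + (\<mu> *\<^sub>C S.R z v -
        (\<mu> *\<^sub>C S.R l v + \<mu> *\<^sub>C \<mu> *\<^sub>C S.R l (S.R z v)))"
      by (simp add: M_def N_def blinfun.add_right S.R_scaleC[OF l(1)] scaleC_add_right)
    ultimately show ?thesis by simp
  qed
  have NM: "N (M v) = v" for v
  proof -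
    have "S.R z v = S.R l v + \<mu> *\<^sub>C S.R z (S.R l v)"
      using S.resolvent_identity[OF z l(1), of v] by (simp add: \<mu>_def algebra_simps)
    then have "\<mu> *\<^sub>C S.R z v = \<mu> *\<^sub>C S.R l v + \<mu> *\<^sub>C \<mu> *\<^sub>C S.R z (S.R l v)"
      by (metis scaleC_add_right)
    moreover have "N (M v) = v + (\<mu> *\<^sub>C S.R z v -
        (\<mu> *\<^sub>C S.R l v + \<mu> *\<^sub>C \<mu> *\<^sub>C S.R z (S.R l v)))"
      by (simp add: M_def N_def blinfun.diff_right S.R_scaleC[OF z] scaleC_diff_right)
    ultimately show ?thesis by simp
  qed
  have bij_N: "bij N" using MN NM by (intro o_bij[of M]) auto
  have bij_M: "bij M" using MN NM by (intro o_bij[of N]) auto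

  define q where "q = cmod (z - l) * n * \<delta>"
  \<comment> \<open>\<open>X\<close> measures how far \<open>N\<close> is from inverting
    \<open>I - \<mu> T.R l\<close>: composing gives \<open>I - X\<close>, hence
    \<open>I - \<mu> T.R l = M (I - X)\<close> is bijective once \<open>X\<close> is a
    contraction.\<close>
  define X where "X y = \<mu> *\<^sub>C N (D y)" for y
  have X_diff: "X (x - y) = X x - X y" for x y
    by (simp add: X_def blinfun.diff_right N_diff scaleC_diff_right)
  have X_norm: "norm (X x) \<le> q * norm x" for x
  proof -
    have "norm (X x) = cmod \<mu> * norm (N (D x))" by (simp add: X_def norm_scaleC)
    also have "\<dots> \<le> cmod \<mu> * (n * (\<delta> * norm x))"
      using N_norm[of "D x"] norm_blinfun[of D x] n1 unfolding \<delta>_def D_def[symmetric]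
      by (meson mult_left_mono norm_ge_zero order_trans zero_le_one)
    finally show ?thesis by (simp add: q_def \<mu>_def mult.assoc)
  qed
  have q: "q < 1" using small by (simp add: q_def)
  note contr = bij_id_minus_contraction[of X, OF X_diff X_norm q]
  have NMX: "N (y - \<mu> *\<^sub>C T.R l y) = y - X y" for y
  proof -
    have "y - \<mu> *\<^sub>C T.R l y = M y - \<mu> *\<^sub>C D y"
      by (simp add: M_def D_def blinfun.diff_left scaleC_diff_right)
    then show ?thesis by (simp add: N_diff N_scaleC NM X_def)
  qed
  then have "(\<lambda>y. y - \<mu> *\<^sub>C T.R l y) = M \<circ> (\<lambda>y. y - X y)"
    by (metis (no_types, lifting) MN NM comp_apply ext)
  then have bij: "bij (\<lambda>y. y - \<mu> *\<^sub>C T.R l y)" using bij_M contr(1) by (simp add: bij_comp)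
  show zT: "z \<in> resolvent_set H\<^sub>T T"
  proof (rule T.resolvent_setI[OF l(2)])
    show "bij (\<lambda>y. y - (z - l) *\<^sub>C T.R l y)" using bij unfolding \<mu>_def .
    fix y
    have "(1 - q) * norm y \<le> n * norm (y - \<mu> *\<^sub>C T.R l y)"
      using contr(2)[of y] N_norm[of "y - \<mu> *\<^sub>C T.R l y"] NMX[of y] by simp
    then show "norm y \<le> (n / (1 - q)) * norm (y - (z - l) *\<^sub>C T.R l y)"
      using q by (simp add: \<mu>_def field_simps)
  qed

  \<comment> \<open>The difference factors as \<open>T.R z - S.R z = N D (I + \<mu> T.R z)\<close>,
    where \<open>v\<close> below is the image of \<open>x\<close> under the last factor.\<close>
  let ?t = "norm (T.R z - S.R z)"
  have "?t \<le> n * \<delta> * (1 + cmod \<mu> * norm (T.R z))"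
  proof (rule norm_blinfun_bound)
    show "0 \<le> n * \<delta> * (1 + cmod \<mu> * norm (T.R z))" using n1 by (simp add: \<delta>_def)
    fix x
    define v where "v = x + \<mu> *\<^sub>C T.R z x"
    have "T.R z x = T.R l x + \<mu> *\<^sub>C T.R l (T.R z x)"
      using T.resolvent_identity[OF l(2) zT, of x] scaleC_minus_left[of \<mu> "T.R l (T.R z x)"]
      by (simp add: \<mu>_def algebra_simps)
    then have Tv: "T.R l v = T.R z x"
      by (simp add: v_def blinfun.add_right T.R_scaleC[OF l(2)])
    have "N (S.R l v) = S.R z v"
      using S.resolvent_identity[OF z l(1), of v] by (simp add: N_def \<mu>_def algebra_simps)
    then have "N (D v) = N (T.R z x) - S.R z v"
      by (simp add: D_def blinfun.diff_left N_diff Tv)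
    also have "\<dots> = (T.R z - S.R z) x"
      by (simp add: N_def v_def blinfun.add_right blinfun.diff_left S.R_scaleC[OF z])
    finally have "norm ((T.R z - S.R z) x) = norm (N (D v))" by simp
    also have "\<dots> \<le> n * (\<delta> * norm v)"
      using N_norm[of "D v"] norm_blinfun[of D v] n1 unfolding \<delta>_def D_def[symmetric]
      by (meson mult_left_mono order_trans zero_le_one)
    also have "norm v \<le> norm x + cmod \<mu> * norm (T.R z x)"
      unfolding v_def by (rule order_trans[OF norm_triangle_ineq]) (simp add: norm_scaleC)
    also have "cmod \<mu> * norm (T.R z x) \<le> cmod \<mu> * (norm (T.R z) * norm x)"
      by (intro mult_left_mono norm_blinfun) simp
    finally have "norm ((T.R z - S.R z) x) \<le> n * (\<delta> * (norm x + cmod \<mu> * (norm (T.R z) * norm x)))"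
      using n1 by (simp add: \<delta>_def mult_left_mono)
    then show "norm ((T.R z - S.R z) x) \<le> n * \<delta> * (1 + cmod \<mu> * norm (T.R z)) * norm x"
      by (simp add: algebra_simps)
  qed
  also have "\<dots> \<le> n * \<delta> * (n + cmod \<mu> * ?t)"
  proof (rule mult_left_mono)
    \<comment> \<open>The unknown norm of \<open>T.R z\<close> is bounded through \<open>?t\<close>
      itself; the resulting term in \<open>?t\<close> is finally moved to the left-hand
      side.\<close>
    have "norm (T.R z) \<le> b + ?t"
      using b norm_triangle_ineq[of "S.R z" "T.R z - S.R z"] by simp
    then have "cmod \<mu> * norm (T.R z) \<le> cmod \<mu> * (b + ?t)" by (rule mult_left_mono) simp
    then show "1 + cmod \<mu> * norm (T.R z) \<le> n + cmod \<mu> * ?t"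
      by (simp add: n_def \<mu>_def algebra_simps)
  qed (use n1 in \<open>simp add: \<delta>_def\<close>)
  finally show "?t * (1 - cmod (z - l) * n * \<delta>) \<le> n\<^sup>2 * \<delta>"
    by (simp add: \<mu>_def algebra_simps power2_eq_square)
qed

end

section \<open>Hausdorff convergence of pseudospectra\<close>

text \<open>The topological part. For each one-sided distance a compact set is covered by finitely
  many open sets, which makes finitely many eventual statements hold simultaneously.\<close>

lemma hausdorff_tendsto:
  fixes A :: "complex set" and B :: "nat \<Rightarrow> complex set"
  assumes K: "compact K" and eq: "closure A \<inter> K = closure (A \<inter> K)"
    and ne: "closure (A \<inter> K) \<noteq> {}"
    and inner: "\<And>z. z \<in> A \<Longrightarrow> \<forall>\<^sub>F k in sequentially. z \<in> B k"
    and outer: "\<And>z. z \<notin> closure A \<Longrightarrow>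
      \<exists>U. open U \<and> z \<in> U \<and> (\<forall>\<^sub>F k in sequentially. U \<inter> B k = {})"
  shows "\<forall>\<^sub>F k in sequentially. closure (B k) \<inter> K \<noteq> {}"
    and "(\<lambda>k. hausdorff_dist (closure (B k) \<inter> K) (closure A \<inter> K)) \<longlonglongrightarrow> 0"
proof -
  let ?S = "closure A \<inter> K" and ?Sk = "\<lambda>k. closure (B k) \<inter> K"
  obtain a where a: "a \<in> A \<inter> K" using ne by auto
  show ev_ne: "\<forall>\<^sub>F k in sequentially. ?Sk k \<noteq> {}"
    using inner[of a] a by (auto elim!: eventually_mono dest: subsetD[OF closure_subset])
  have far: "\<forall>\<^sub>F k in sequentially. \<forall>z \<in> ?Sk k. infdist z ?S < d" if "d > 0" for d
  proof -
    \<comment> \<open>The part of \<open>K\<close> at distance at least \<open>d\<close> from the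
      limit set misses \<open>closure A\<close>, so \<open>outer\<close> supplies a cover of it by
      sets that eventually avoid \<open>B k\<close>, and, being open, also its closure.\<close>
    define C where "C = K \<inter> {z. d \<le> infdist z ?S}"
    have "compact C" unfolding C_def using K
      by (intro compact_Int_closed closed_Collect_le continuous_intros)
    have "\<exists>U. open U \<and> z \<in> U \<and> (\<forall>\<^sub>F k in sequentially. U \<inter> B k = {})" if "z \<in> C" for z
    proof (rule outer)
      show "z \<notin> closure A"
        using that \<open>d > 0\<close> infdist_zero[of z ?S] unfolding C_def by auto
    qed
    then obtain U where U: "\<And>z. z \<in> C \<Longrightarrow> open (U z)" "\<And>z. z \<in> C \<Longrightarrow> z \<in> U z"
      "\<And>z. z \<in> C \<Longrightarrow> \<forall>\<^sub>F k in sequentially. U z \<inter> B k = {}" by metis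
    obtain F where F: "F \<subseteq> C" "finite F" "C \<subseteq> (\<Union>z\<in>F. U z)"
      by (rule compactE_image[OF \<open>compact C\<close>, of C U]) (use U in auto)
    have "\<forall>\<^sub>F k in sequentially. \<forall>z\<in>F. U z \<inter> B k = {}"
      using F U(3) by (auto simp: eventually_ball_finite_distrib)
    then show ?thesis
    proof eventually_elim
      case (elim k)
      show ?case
      proof (intro ballI, rule ccontr)
        fix z assume z: "z \<in> ?Sk k" "\<not> infdist z ?S < d"
        then have "z \<in> C" by (auto simp: C_def)
        then obtain f where f: "f \<in> F" "z \<in> U f" using F by blast
        then have "U f \<inter> closure (B k) = {}"
          using elim U(1)[of f] F(1) by (simp add: open_Int_closure_eq_empty subsetD)
        with f z show False by auto
      qed
    qed
  qed
  have near: "\<forall>\<^sub>F k in sequentially. \<forall>z \<in> ?S. infdist z (?Sk k) < d" if "d > 0" for d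
  proof -
    have cpt: "compact ?S" using K by (simp add: closed_Int_compact)
    \<comment> \<open>Here \<open>eq\<close> enters: the centres can be taken in
      \<open>A \<inter> K\<close>, so that they eventually lie in \<open>B k\<close> while remaining
      in \<open>K\<close>.\<close>
    have cover: "?S \<subseteq> (\<Union>w\<in>A \<inter> K. ball w d)"
    proof
      fix z assume "z \<in> ?S"
      then have "z \<in> closure (A \<inter> K)" using eq by simp
      then obtain w where "w \<in> A \<inter> K" "dist w z < d"
        using \<open>d > 0\<close> by (meson closure_approachable)
      then show "z \<in> (\<Union>w\<in>A \<inter> K. ball w d)" by auto
    qed
    obtain F where F: "F \<subseteq> A \<inter> K" "finite F" "?S \<subseteq> (\<Union>w\<in>F. ball w d)"
      by (rule compactE_image[OF cpt _ cover]) auto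
    have "\<forall>\<^sub>F k in sequentially. \<forall>w\<in>F. w \<in> B k"
      using F inner by (auto simp: eventually_ball_finite_distrib)
    then show ?thesis
    proof eventually_elim
      case (elim k)
      show ?case
      proof
        fix z assume "z \<in> ?S"
        then obtain w where w: "w \<in> F" "dist w z < d" using F by auto
        then have "w \<in> ?Sk k" using elim F closure_subset[of "B k"] by auto
        from infdist_le[OF this, of z] w show "infdist z (?Sk k) < d" by (simp add: dist_commute)
      qed
    qed
  qed
  show "(\<lambda>k. hausdorff_dist (?Sk k) ?S) \<longlonglongrightarrow> 0"
  proof (rule tendstoI)
    fix e :: real assume "e > 0"
    \<comment> \<open>Strict pointwise bounds yield only weak bounds for the suprema; half of
      \<open>e\<close> leaves room for strictness.\<close>
    then have "e / 2 > 0" by simp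
    from ev_ne far[OF this] near[OF this]
    show "\<forall>\<^sub>F k in sequentially. dist (hausdorff_dist (?Sk k) ?S) 0 < e"
    proof eventually_elim
      case (elim k)
      have S: "?S \<noteq> {}" using ne eq by simp
      have 1: "(SUP z\<in>?Sk k. infdist z ?S) \<le> e / 2"
        using elim by (intro cSUP_least) (auto intro: less_imp_le)
      have 2: "(SUP z\<in>?S. infdist z (?Sk k)) \<le> e / 2"
        using elim S by (intro cSUP_least) (auto intro: less_imp_le)
      obtain z where z: "z \<in> ?S" using S by blast
      have "0 \<le> infdist z (?Sk k)" by (rule infdist_nonneg)
      also have "\<dots> \<le> (SUP z\<in>?S. infdist z (?Sk k))"
        using z elim by (intro cSUP_upper bdd_aboveI2[where M = "e / 2"]) (auto intro: less_imp_le)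
      finally show ?case using 1 2 \<open>e > 0\<close> by (simp add: hausdorff_dist_def)
    qed
  qed
qed

section \<open>Pseudospectra along a convergent sequence of operators\<close>

locale resolvent_convergence = T: hilbert_operator H T
  for H :: "'a::chilbert_space set" and T :: "'a operator" +
  fixes Hk :: "nat \<Rightarrow> 'a set" and Tk :: "nat \<Rightarrow> 'a operator" and l :: complex
  assumes operators: "\<And>k. hilbert_operator (Hk k) (Tk k)"
    and l: "l \<in> resolvent_set H T" and lk: "\<And>k. l \<in> resolvent_set (Hk k) (Tk k)"
    and conv: "(\<lambda>k. norm (hilbert_operator.R (Hk k) (Tk k) l - T.R l)) \<longlonglongrightarrow> 0"
begin

sublocale Tk: hilbert_operator "Hk k" "Tk k" for k by (rule operators)

lemma eventually_small: "\<forall>\<^sub>F k in sequentially. c * norm (Tk.R k l - T.R l) < 1"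
  using order_tendstoD(2)[OF tendsto_mult_right_zero[OF conv, of c], of 1] by simp

text \<open>The perturbation estimate is applied from the fixed operator \<open>T\<close> to
  \<open>Tk k\<close>, with \<open>b = norm (T.R z)\<close>.\<close>

lemma eventually_resolvent_set:
  assumes z: "z \<in> resolvent_set H T"
  shows "\<forall>\<^sub>F k in sequentially. z \<in> resolvent_set (Hk k) (Tk k)"
    and "(\<lambda>k. norm (Tk.R k z)) \<longlonglongrightarrow> norm (T.R z)"
proof -
  define n where "n = 1 + cmod (z - l) * norm (T.R z)"
  define d where "d k = norm (Tk.R k l - T.R l)" for k
  \<comment> \<open>The factor \<open>2\<close> keeps \<open>1 - cmod (z - l) * n * d k\<close>
    above \<open>1/2\<close>, so it can be divided out of the estimate.\<close>
  have ev: "\<forall>\<^sub>F k in sequentially. 2 * cmod (z - l) * n * d k < 1"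
    unfolding d_def by (rule eventually_small)
  have main: "z \<in> resolvent_set (Hk k) (Tk k) \<and> norm (Tk.R k z - T.R z) \<le> 2 * n\<^sup>2 * d k"
    if "2 * cmod (z - l) * n * d k < 1" for k
  proof -
    interpret hilbert_operator_pair H T "Hk k" "Tk k" ..
    have "n \<ge> 0" by (simp add: n_def)
    then have less: "cmod (z - l) * n * d k < 1" using that by (simp add: d_def mult.assoc)
    note pert = resolvent_perturbation[OF l lk[of k] z order_refl, folded n_def d_def, OF less]
    have "norm (Tk.R k z - T.R z) * (1/2) \<le> norm (Tk.R k z - T.R z) * (1 - cmod (z - l) * n * d k)"
      using that by (intro mult_left_mono) auto
    with pert show ?thesis by simp
  qed
  show "\<forall>\<^sub>F k in sequentially. z \<in> resolvent_set (Hk k) (Tk k)"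
    using ev by eventually_elim (use main in blast)
  have "(\<lambda>k. 2 * n\<^sup>2 * d k) \<longlonglongrightarrow> 0"
    unfolding d_def by (rule tendsto_mult_right_zero[OF conv])
  moreover have "\<forall>\<^sub>F k in sequentially. norm (Tk.R k z - T.R z) \<le> 2 * n\<^sup>2 * d k"
    using ev by eventually_elim (use main in blast)
  ultimately have "(\<lambda>k. Tk.R k z - T.R z) \<longlonglongrightarrow> 0" by (rule Lim_null_comparison[rotated])
  then have "(\<lambda>k. Tk.R k z) \<longlonglongrightarrow> T.R z" by (rule LIM_zero_cancel)
  then show "(\<lambda>k. norm (Tk.R k z)) \<longlonglongrightarrow> norm (T.R z)" by (rule tendsto_norm)
qed

text \<open>On the resolvent set of \<open>T\<close> the norms converge. At a spectral point the
  roles are exchanged: were \<open>z\<close> outside the pseudospectrum of \<open>Tk k\<close>, the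
  bound \<open>1 / \<epsilon>\<close>, independent of \<open>k\<close>, would let the perturbation
  estimate carry \<open>z\<close> into the resolvent set of \<open>T\<close>.\<close>

lemma eventually_in_pseudospectrum:
  assumes z: "z \<in> pseudospectrum H T \<epsilon>"
  shows "\<forall>\<^sub>F k in sequentially. z \<in> pseudospectrum (Hk k) (Tk k) \<epsilon>"
proof (cases "z \<in> resolvent_set H T")
  case True
  with z have "norm (T.R z) > 1 / \<epsilon>" by (simp add: T.pseudospectrum_iff)
  with eventually_resolvent_set(2)[OF True] have "\<forall>\<^sub>F k in sequentially. norm (Tk.R k z) > 1 / \<epsilon>"
    by (rule order_tendstoD(1))
  then show ?thesis by eventually_elim (simp add: Tk.pseudospectrum_iff)
next
  case False
  have "\<forall>\<^sub>F k in sequentially. (cmod (z - l) * (1 + cmod (z - l) * (1 / \<epsilon>))) * norm (Tk.R k l - T.R l) < 1"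
    by (rule eventually_small)
  then show ?thesis
  proof eventually_elim
    case (elim k)
    interpret hilbert_operator_pair "Hk k" "Tk k" H T ..
    show ?case
    proof (rule ccontr)
      assume "z \<notin> pseudospectrum (Hk k) (Tk k) \<epsilon>"
      then have "z \<in> resolvent_set (Hk k) (Tk k)" "norm (Tk.R k z) \<le> 1 / \<epsilon>"
        by (auto simp: Tk.pseudospectrum_iff)
      from resolvent_perturbation(1)[OF lk l this] elim False show False
        by (simp add: norm_minus_commute)
    qed
  qed
qed

text \<open>
  Non-constancy of the resolvent norm enters only here: by the maximum principle, the norm at an
  interior point of the complement of the pseudospectrum is strictly less than \<open>1 / \<epsilon>\<close>.
\<close>

lemma eventually_disjoint_pseudospectrum:
  assumes nonconst: "\<And>U. open U \<Longrightarrow> U \<noteq> {} \<Longrightarrow> U \<subseteq> resolvent_set H T \<Longrightarrow>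
      \<not> resolvent_norm H T constant_on U"
    and \<epsilon>: "\<epsilon> > 0" and z: "z \<notin> closure (pseudospectrum H T \<epsilon>)"
  shows "\<exists>U. open U \<and> z \<in> U \<and> (\<forall>\<^sub>F k in sequentially. U \<inter> pseudospectrum (Hk k) (Tk k) \<epsilon> = {})"
proof -
  obtain r where r: "r > 0" "ball z r \<subseteq> - closure (pseudospectrum H T \<epsilon>)"
    using z open_contains_ball[of "- closure (pseudospectrum H T \<epsilon>)"] by auto
  then have outside: "w \<notin> pseudospectrum H T \<epsilon>" if "w \<in> ball z r" for w
    using that closure_subset by blast
  then have sub: "ball z r \<subseteq> resolvent_set H T" by (auto simp: T.pseudospectrum_iff)
  have le: "norm (T.R w) \<le> 1 / \<epsilon>" if "w \<in> ball z r" for w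
    using outside[OF that] by (simp add: T.pseudospectrum_iff not_less)
  have "\<not> resolvent_norm H T constant_on ball z r"
    using nonconst[of "ball z r"] r(1) sub by simp
  then have "\<not> (\<lambda>w. norm (T.R w)) constant_on ball z r"
    using sub T.resolvent_norm_eq unfolding constant_on_def by (metis subsetD)
  with r(1) sub le have "norm (T.R z) < 1 / \<epsilon>" by (intro T.norm_R_less) auto
  \<comment> \<open>The gap below \<open>1 / \<epsilon>\<close> gives the bound \<open>b\<close> at
    the single point \<open>z\<close> for all large \<open>k\<close>; \<open>resolvent_near\<close>
    then spreads it to a ball whose radius does not depend on \<open>k\<close>.\<close>
  then obtain b where b: "norm (T.R z) < b" "b < 1 / \<epsilon>" using dense by blast
  have b0: "b > 0" using b(1) norm_ge_zero[of "T.R z"] by linarith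
  \<comment> \<open>With this radius \<open>1 - cmod (w - z) * b \<ge> \<epsilon> * b\<close>, so
    the resolvent norm at \<open>w\<close> is at most
    \<open>b / (\<epsilon> * b) = 1 / \<epsilon>\<close>.\<close>
  define d where "d = 1 / b - \<epsilon>"
  have d: "d > 0" using b(2) b0 \<epsilon> by (simp add: d_def field_simps)
  have zT: "z \<in> resolvent_set H T" using sub r(1) by auto
  have "\<forall>\<^sub>F k in sequentially. ball z d \<inter> pseudospectrum (Hk k) (Tk k) \<epsilon> = {}"
    using eventually_resolvent_set(1)[OF zT]
      order_tendstoD(2)[OF eventually_resolvent_set(2)[OF zT] b(1)]
  proof eventually_elim
    case (elim k)
    have "w \<notin> pseudospectrum (Hk k) (Tk k) \<epsilon>" if "w \<in> ball z d" for w
    proof -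
      let ?q = "cmod (w - z) * norm (Tk.R k z)"
      have "cmod (w - z) < d" using that by (simp add: dist_norm norm_minus_commute)
      then have "cmod (w - z) * b \<le> d * b" using b0 by simp
      moreover have "?q \<le> cmod (w - z) * b" using elim by (intro mult_left_mono) auto
      moreover have "d * b = 1 - \<epsilon> * b" using b0 by (simp add: d_def field_simps)
      ultimately have q: "\<epsilon> * b \<le> 1 - ?q" by linarith
      then have less: "?q < 1" using b0 \<epsilon> by (smt (verit) mult_pos_pos)
      have "norm (Tk.R k w) * (\<epsilon> * b) \<le> norm (Tk.R k w) * (1 - ?q)"
        using q by (rule mult_left_mono) simp
      also have "\<dots> \<le> norm (Tk.R k z)" by (rule Tk.resolvent_near(2)[OF elim(1) less])
      also have "\<dots> \<le> b" using elim by simp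
      finally have "norm (Tk.R k w) \<le> 1 / \<epsilon>" using b0 \<epsilon> by (simp add: field_simps)
      with Tk.resolvent_near(1)[OF elim(1) less] show ?thesis by (simp add: Tk.pseudospectrum_iff)
    qed
    then show ?case by blast
  qed
  with d show ?thesis by (intro exI[of _ "ball z d"]) auto
qed

end

theorem theorem2p1:
  fixes H :: "'a::chilbert_space set"
    and Hk :: "nat \<Rightarrow> 'a set"
    and T :: "'a operator"
    and Tk :: "nat \<Rightarrow> 'a operator"
    and K :: "complex set"
    and \<epsilon> :: real
  assumes "closed_csubspace H"
    and "\<And>k. closed_csubspace (Hk k)"
    and "linear_operator_in H T" "closed_operator T" "densely_defined_in H T"
    and "\<And>k. linear_operator_in (Hk k) (Tk k)"
    and "\<And>k. closed_operator (Tk k)"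
    and "\<And>k. densely_defined_in (Hk k) (Tk k)"
    and "(\<Inter>k. resolvent_set (Hk k) (Tk k)) \<inter> resolvent_set H T \<noteq> {}"
    and "compact K"
    and "\<epsilon> > 0"
    and "closure (pseudospectrum H T \<epsilon>) \<inter> K = closure (pseudospectrum H T \<epsilon> \<inter> K)"
    and "closure (pseudospectrum H T \<epsilon> \<inter> K) \<noteq> {}"
    and "\<And>U. open U \<Longrightarrow> U \<noteq> {} \<Longrightarrow> U \<subseteq> resolvent_set H T \<Longrightarrow>
           \<not> resolvent_norm H T constant_on U"
    and "gen_norm_resolvent_convergence Hk Tk H T"
  shows "(\<forall>\<^sub>F k in sequentially. closure (pseudospectrum (Hk k) (Tk k) \<epsilon>) \<inter> K \<noteq> {}) \<and>
         (\<lambda>k. hausdorff_dist (closure (pseudospectrum (Hk k) (Tk k) \<epsilon>) \<inter> K)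
                             (closure (pseudospectrum H T \<epsilon>) \<inter> K)) \<longlonglongrightarrow> 0"
proof -
  interpret T: hilbert_operator H T by unfold_locales fact+
  have op_k: "hilbert_operator (Hk k) (Tk k)" for k by unfold_locales fact+
  from assms(15) obtain l where l: "l \<in> resolvent_set H T" "\<And>k. l \<in> resolvent_set (Hk k) (Tk k)"
    and lim: "(\<lambda>k. onorm (\<lambda>x. resolvent (Tk k) l (orth_proj (Hk k) x)
      - resolvent T l (orth_proj H x))) \<longlonglongrightarrow> 0"
    unfolding gen_norm_resolvent_convergence_def by blast
  \<comment> \<open>Identifies the operator norm in the definition of convergence with the norm of a
    difference of extended resolvents.\<close>
  have "blinfun_apply (hilbert_operator.R (Hk k) (Tk k) l - T.R l) =
      (\<lambda>x. resolvent (Tk k) l (orth_proj (Hk k) x) - resolvent T l (orth_proj H x))" for k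
    by (rule ext) (simp add: blinfun.diff_left T.R_apply[OF l(1)]
        hilbert_operator.R_apply[OF op_k l(2)])
  with lim have "(\<lambda>k. norm (hilbert_operator.R (Hk k) (Tk k) l - T.R l)) \<longlonglongrightarrow> 0"
    by (simp add: norm_blinfun.rep_eq)
  then interpret resolvent_convergence H T Hk Tk l
    using op_k l assms(2,6) by unfold_locales auto
  show ?thesis
    using hausdorff_tendsto[OF assms(10,12,13) eventually_in_pseudospectrum
        eventually_disjoint_pseudospectrum[OF assms(14,11)]]
    by blast
qed

end
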